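(* Let $G$ be a countable abelian group acting on a measure space $(X,\mathcal{B},\mu)$, let $A\subset G$ be finite, and let $B\in\mathcal{B}$ have finite positive measure. Then for all positive integers $j<k$ we have $$c(A^k,B)^{1/k} \leq c(A^j,B)^{1/j}.$$
   Context: A group $G$ acts on a measure space $(X,\mathcal{B},\mu)$ if for each $g\in G$ the map $x\mapsto g.x$ is measure preserving, i.e. it is measurable and $\mu(gB)=\mu(B)$ for every $B\in\mathcal{B}$. For $A\subset G$ and $B\subset X$, $AB=\{a.b : a\in A, b\in B\}$. For $A\subset G$, $A^1=A$ and $A^k=A^{k-1}A$ for $k>1$ (iterated product sets). For $A\subset G$ and $B\in\mathcal{B}$ of finite positive measure, the magnification ratio is $$c(A,B)=\inf\left\{\frac{\mu(AB')}{\mu(B')} : B'\subset B \text{ measurable},\ \mu(B')>0\right\}.$$ *)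

theory Defs
  imports "HOL-Analysis.Analysis" "HOL-Algebra.Group_Action"
begin

locale measure_action = group_action G "space M" \<phi>
  for G (structure) and M :: "'x measure" and \<phi> +
  assumes action_measurable: "g \<in> carrier G \<Longrightarrow> \<phi> g \<in> measurable M M"
    and action_emeasure:
      "g \<in> carrier G \<Longrightarrow> B \<in> sets M \<Longrightarrow> emeasure M (\<phi> g ` B) = emeasure M B"

definition act_set :: "('g \<Rightarrow> 'x \<Rightarrow> 'x) \<Rightarrow> 'g set \<Rightarrow> 'x set \<Rightarrow> 'x set"
  where "act_set \<phi> A B = {\<phi> a b | a b. a \<in> A \<and> b \<in> B}"

primrec set_power :: "('g, 'm) monoid_scheme \<Rightarrow> 'g set \<Rightarrow> nat \<Rightarrow> 'g set"
  where
    "set_power G A 0 = {\<one>\<^bsub>G\<^esub>}"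
  | "set_power G A (Suc k) = set_power G A k <#>\<^bsub>G\<^esub> A"

lemma (in monoid) set_power_1:
  assumes "A \<subseteq> carrier G"
  shows "set_power G A 1 = A"
  using assms by (force simp: set_mult_def)

text \<open>The infimum is taken in the extended nonnegative reals, so that the ratio also makes sense
  when \<open>act_set \<phi> A B'\<close> has infinite measure.\<close>

definition magnification_ratio ::
    "'x measure \<Rightarrow> ('g \<Rightarrow> 'x \<Rightarrow> 'x) \<Rightarrow> 'g set \<Rightarrow> 'x set \<Rightarrow> ennreal"
  where "magnification_ratio M \<phi> A B =
    Inf {emeasure M (act_set \<phi> A B') / emeasure M B' | B'.
           B' \<in> sets M \<and> B' \<subseteq> B \<and> 0 < emeasure M B'}"

lemma (in measure_action) image_sets:
  assumes g: "g \<in> carrier G" and B: "B \<in> sets M"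
  shows "\<phi> g ` B \<in> sets M"
proof -
  interpret group G
    using group_hom by (simp add: group_hom_def)
  have BX: "B \<subseteq> space M"
    by (rule sets.sets_into_space[OF B])
  have ig: "inv g \<in> carrier G"
    using g by simp
  have "\<phi> g ` B = \<phi> (inv g) -` B \<inter> space M"
  proof (intro equalityI subsetI)
    fix y assume "y \<in> \<phi> g ` B"
    then obtain b where b: "b \<in> B" "y = \<phi> g b" by blast
    then show "y \<in> \<phi> (inv g) -` B \<inter> space M"
      using BX g element_image[OF g] orbit_sym_aux[OF g] by auto
  next
    fix y assume y: "y \<in> \<phi> (inv g) -` B \<inter> space M"
    then have "\<phi> g (\<phi> (inv g) y) = y"
      using orbit_sym_aux[OF ig, of y "\<phi> (inv g) y"] g by simp
    then show "y \<in> \<phi> g ` B"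
      using y by (metis IntD1 image_eqI vimageD)
  qed
  then show ?thesis
    using measurable_sets[OF action_measurable[OF ig] B] by simp
qed

text \<open>For finite \<open>A\<close> the ratio is finite, so applying \<^const>\<open>enn2real\<close> to it loses nothing.\<close>

lemma (in measure_action) magnification_ratio_finite:
  assumes A: "finite A" "A \<subseteq> carrier G"
    and B: "B \<in> sets M" "0 < emeasure M B" "emeasure M B < \<infinity>"
  shows "magnification_ratio M \<phi> A B < \<infinity>"
proof -
  have "act_set \<phi> A B = (\<Union>a\<in>A. \<phi> a ` B)"
    by (auto simp: act_set_def)
  then have "emeasure M (act_set \<phi> A B) \<le> (\<Sum>a\<in>A. emeasure M (\<phi> a ` B))"
    using A B image_sets by (auto intro!: emeasure_subadditive_finite)
  also have "\<dots> = (\<Sum>a\<in>A. emeasure M B)"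
    using A B by (intro sum.cong refl action_emeasure) auto
  also have "\<dots> < \<infinity>"
    using A B by (simp add: ennreal_mult_less_top of_nat_less_top)
  finally have "emeasure M (act_set \<phi> A B) / emeasure M B < \<infinity>"
    using B by (auto simp: less_top[symmetric] ennreal_divide_eq_top_iff)
  moreover have "magnification_ratio M \<phi> A B \<le> emeasure M (act_set \<phi> A B) / emeasure M B"
    unfolding magnification_ratio_def using B by (intro Inf_lower) auto
  ultimately show ?thesis by simp
qed

end

theory Submission
  imports Defs
begin

text \<open>
  This is Pluennecke's inequality for a measure preserving action.  Write \<open>AZ\<close> for
  \<open>act_set \<phi> A Z\<close> and let \<open>C ^ h\<close> be the magnification ratio of \<open>A ^ h\<close> on \<open>B\<close>, so that
  \<open>\<mu> (A ^ h Z) \<ge> C ^ h \<mu> Z\<close> for all measurable \<open>Z \<subseteq> B\<close>.  What has to be shown is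
  \<open>\<mu> (A ^ j Z) \<ge> C ^ j \<mu> Z\<close> for \<open>0 < j \<le> h\<close>.  The argument is an approximate version of Petridis's
  proof by minimal weighted cuts, which uses neither Menger's theorem nor product graphs.

  Consider the layered graph with layers \<open>0, \<dots>, h\<close>, each a copy of the space, whose edges lead
  from \<open>x\<close> in one layer to \<open>\<phi> a x\<close> in the next, for \<open>a \<in> A\<close>.  A cut between \<open>B\<close> in layer \<open>0\<close> and
  layer \<open>h\<close> is described by sets \<open>R i\<close> of points that lie on the source side, with \<open>R 0 \<subseteq> B\<close> and
  \<open>R h = {}\<close>; the cut itself consists of \<open>B - R 0\<close> in layer \<open>0\<close> and of \<open>A(R i) - R (i + 1)\<close> in
  layer \<open>i + 1\<close>.  A point of layer \<open>i\<close> has weight \<open>1 / C ^ i\<close>.  If every cut costs at least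
  \<open>\<mu> B\<close>, then the theorem follows from the cut that consists of \<open>B - Z\<close> in layer \<open>0\<close>
  and \<open>A ^ j Z\<close> in layer \<open>j\<close>: its cost is \<open>\<mu> B - \<mu> Z + \<mu> (A ^ j Z) / C ^ j\<close>.

  A cut contained in layers \<open>0\<close> and \<open>h\<close> costs at least \<open>\<mu> B\<close> by the choice of \<open>C\<close>, so it is
  enough to move a cut of nearly minimal cost out of the intermediate layers at little extra cost.
  Let \<open>S\<close> be the part of the cut in one such layer.  A part \<open>T\<close> of \<open>S\<close> can be pushed to the new
  out-neighbours of \<open>T\<close>, and a part \<open>U\<close> of \<open>S\<close> can be pulled back to the in-neighbours of \<open>U\<close>;
  by near minimality neither move gains much.  Commutativity of the maps makes the
  in-degree nondecreasing and the out-degree nonincreasing along edges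
  near \<open>S\<close>.  Counting edges by the level sets of the two degrees
  (\<open>degree_level_sets\<close>) then gives one inequality between pushes \<open>T\<close> and pulls \<open>U\<close> that forces
  every one of them to be nearly cost neutral (\<open>push_near_minimal\<close>).  One of the pushes moves all
  of \<open>S\<close>.  Repeating this layer by layer empties the intermediate layers
  (\<open>near_minimal_with_empty_middle\<close>).  The infimum of the cost need not be attained, which is
  why all this is done up to an arbitrary error \<open>\<epsilon>\<close>.
\<close>

section \<open>Comparing measures of families of sets by counting\<close>

lemma sum_measure_eq_integral_count:
  assumes fin: "finite I" and X: "\<And>i. i \<in> I \<Longrightarrow> X i \<in> fmeasurable M"
  shows "(\<Sum>i\<in>I. measure M (X i)) = (\<integral>x. real (card {i \<in> I. x \<in> X i}) \<partial>M)"
    and "integrable M (\<lambda>x. real (card {i \<in> I. x \<in> X i}))"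
proof -
  have count: "(\<lambda>x. real (card {i \<in> I. x \<in> X i})) = (\<lambda>x. \<Sum>i\<in>I. indicator (X i) x)"
    using fin by (simp add: fun_eq_iff indicator_def sum.If_cases Int_def)
  have int: "integrable M (indicator (X i) :: _ \<Rightarrow> real)" if "i \<in> I" for i
    using X[OF that] by (auto simp: fmeasurable_def intro: integrable_real_indicator)
  show "integrable M (\<lambda>x. real (card {i \<in> I. x \<in> X i}))"
    unfolding count by (intro Bochner_Integration.integrable_sum int)
  have "(\<integral>x. (\<Sum>i\<in>I. indicator (X i) x :: real) \<partial>M) = (\<Sum>i\<in>I. measure M (X i))"
    using X by (subst Bochner_Integration.integral_sum) (auto intro!: int sum.cong dest: fmeasurableD)
  then show "(\<Sum>i\<in>I. measure M (X i)) = (\<integral>x. real (card {i \<in> I. x \<in> X i}) \<partial>M)"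
    unfolding count by simp
qed

text \<open>The measure-theoretic form of double counting: a pointwise comparison of multiplicities is
  integrated.\<close>

lemma sum_measure_le_of_count_le:
  assumes fin: "finite I" "finite J"
    and X: "\<And>i. i \<in> I \<Longrightarrow> X i \<in> fmeasurable M"
    and Y: "\<And>j. j \<in> J \<Longrightarrow> Y j \<in> fmeasurable M"
    and count: "\<And>x. x \<in> space M \<Longrightarrow> card {i \<in> I. x \<in> X i} \<le> card {j \<in> J. x \<in> Y j}"
  shows "(\<Sum>i\<in>I. measure M (X i)) \<le> (\<Sum>j\<in>J. measure M (Y j))"
  using sum_measure_eq_integral_count[OF fin(1) X] sum_measure_eq_integral_count[OF fin(2) Y] count
  by (auto intro: integral_mono)

lemma count_level_set_fmeasurable:
  assumes fin: "finite A" and S: "S \<in> fmeasurable M" and Y: "\<And>a. a \<in> A \<Longrightarrow> Y a \<in> sets M"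
  shows "{x \<in> S. t \<le> card {a \<in> A. x \<in> Y a}} \<in> fmeasurable M"
proof -
  have "(\<lambda>x. \<Sum>a\<in>A. indicator (Y a) x :: real) \<in> borel_measurable M"
    using Y by (intro borel_measurable_sum borel_measurable_indicator) auto
  then have "{x \<in> space M. real t \<le> (\<Sum>a\<in>A. indicator (Y a) x)} \<in> sets M"
    by measurable
  moreover have "(\<Sum>a\<in>A. indicator (Y a) x :: real) = real (card {a \<in> A. x \<in> Y a})" for x
    using fin by (simp add: indicator_def sum.If_cases Int_def)
  ultimately have L: "{x \<in> space M. t \<le> card {a \<in> A. x \<in> Y a}} \<in> sets M"
    by simp
  have "{x \<in> S. t \<le> card {a \<in> A. x \<in> Y a}} = S \<inter> {x \<in> space M. t \<le> card {a \<in> A. x \<in> Y a}}"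
    using S sets.sets_into_space by (auto simp: fmeasurable_def)
  then show ?thesis
    using L S by (simp add: fmeasurable_Int_fmeasurable)
qed

section \<open>Finitely many commuting measure preserving maps\<close>

text \<open>The group enters the argument only through the finitely many maps \<open>\<phi> a\<close>.  Different maps may
  agree at some points; for this reason the degrees below count labels \<open>a\<close> and not neighbours.\<close>

locale commuting_measure_maps =
  fixes M :: "'x measure" and \<phi> :: "'a \<Rightarrow> 'x \<Rightarrow> 'x" and A :: "'a set"
  assumes finite_A: "finite A"
    and measurable_map: "a \<in> A \<Longrightarrow> \<phi> a \<in> measurable M M"
    and image_map_sets: "a \<in> A \<Longrightarrow> Y \<in> sets M \<Longrightarrow> \<phi> a ` Y \<in> sets M"
    and emeasure_image_map: "a \<in> A \<Longrightarrow> Y \<in> sets M \<Longrightarrow> emeasure M (\<phi> a ` Y) = emeasure M Y"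
    and commute: "a \<in> A \<Longrightarrow> b \<in> A \<Longrightarrow> x \<in> space M \<Longrightarrow> \<phi> a (\<phi> b x) = \<phi> b (\<phi> a x)"
begin

abbreviation img :: "'x set \<Rightarrow> 'x set"
  where "img \<equiv> act_set \<phi> A"

lemma img_eq_UN: "img Y = (\<Union>a\<in>A. \<phi> a ` Y)"
  by (auto simp: act_set_def)

lemma img_mono: "Y \<subseteq> Z \<Longrightarrow> img Y \<subseteq> img Z"
  by (auto simp: act_set_def)

lemma img_Un: "img (Y \<union> Z) = img Y \<union> img Z"
  by (auto simp: act_set_def)

lemma img_empty [simp]: "img {} = {}"
  by (auto simp: act_set_def)

lemma image_map_fmeasurable:
  "a \<in> A \<Longrightarrow> Y \<in> fmeasurable M \<Longrightarrow> \<phi> a ` Y \<in> fmeasurable M"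
  by (auto simp: fmeasurable_def image_map_sets emeasure_image_map)

lemma img_sets [intro]: "Y \<in> sets M \<Longrightarrow> img Y \<in> sets M"
  unfolding img_eq_UN using finite_A by (intro sets.finite_UN image_map_sets) auto

lemma img_fmeasurable [intro]: "Y \<in> fmeasurable M \<Longrightarrow> img Y \<in> fmeasurable M"
  unfolding img_eq_UN using finite_A by (intro fmeasurable.finite_UN image_map_fmeasurable) auto

lemma vimage_map_fmeasurable:
  assumes "a \<in> A" "Y \<in> fmeasurable M" "Z \<in> sets M"
  shows "{y \<in> Y. \<phi> a y \<in> Z} \<in> fmeasurable M"
proof -
  have "{y \<in> Y. \<phi> a y \<in> Z} = Y \<inter> (\<phi> a -` Z \<inter> space M)"
    using assms sets.sets_into_space by (auto simp: fmeasurable_def)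
  then show ?thesis
    using measurable_sets[OF measurable_map] assms by (simp add: fmeasurable_Int_fmeasurable)
qed

lemma vimage_union_fmeasurable:
  assumes "P \<in> fmeasurable M" "U \<in> sets M"
  shows "{u \<in> P. \<exists>a\<in>A. \<phi> a u \<in> U} \<in> fmeasurable M"
proof -
  have "{u \<in> P. \<exists>a\<in>A. \<phi> a u \<in> U} = (\<Union>a\<in>A. {u \<in> P. \<phi> a u \<in> U})"
    by auto
  then show ?thesis
    using finite_A assms by (auto intro!: fmeasurable.finite_UN vimage_map_fmeasurable)
qed

text \<open>Both sides measure the set of edges labelled \<open>a\<close> that lead from \<open>Y\<close> to \<open>Z\<close>, seen from the
  targets and from the sources.\<close>

lemma measure_Int_image_map:
  assumes "a \<in> A" "Y \<in> fmeasurable M" "Z \<in> sets M"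
  shows "measure M (Z \<inter> \<phi> a ` Y) = measure M {y \<in> Y. \<phi> a y \<in> Z}"
proof -
  have "Z \<inter> \<phi> a ` Y = \<phi> a ` {y \<in> Y. \<phi> a y \<in> Z}"
    by auto
  then show ?thesis
    using vimage_map_fmeasurable[OF assms] assms(1)
    by (simp add: measure_def emeasure_image_map fmeasurable_def)
qed

section \<open>Counting edges by degrees\<close>

text \<open>Here \<open>P\<close> and \<open>Q\<close> are the source sides of a cut in two consecutive layers and \<open>S\<close> is the
  cut in the second of them; \<open>F\<close> in the proof is the set of new points that the source side
  reaches in the third layer once \<open>S\<close> is added to it.  Then \<open>T t\<close> consists of the points
  of \<open>S\<close> with at least \<open>t\<close> incoming edges from \<open>P\<close>, and \<open>U t\<close> of those with at least \<open>t\<close>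
  outgoing edges to \<open>F\<close>.  The point is that a new out-neighbour of \<open>T t\<close> has again at least \<open>t\<close>
  incoming edges from \<open>S\<close>, and an in-neighbour in \<open>P\<close> of \<open>U t\<close> at least \<open>t\<close> outgoing edges
  to \<open>S\<close>.  Hence the sum over \<open>t\<close> of the measures of the new out-neighbours is at most the measure
  of the edges from \<open>S\<close> to \<open>F\<close>, which is the sum of the measures of the \<open>U t\<close>; likewise for the
  edges from \<open>P\<close> to \<open>S\<close>.\<close>

lemma degree_level_sets:
  assumes P: "P \<in> fmeasurable M" and Q: "Q \<in> fmeasurable M"
  defines "S \<equiv> img P - Q"
  obtains T U :: "nat \<Rightarrow> 'x set"
  where "T 1 = S"
    and "\<And>t. T t \<in> fmeasurable M" and "\<And>t. T t \<subseteq> S"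
    and "\<And>t. U t \<in> fmeasurable M" and "\<And>t. U t \<subseteq> S"
    and "(\<Sum>t=1..card A. measure M (img (T t) - img Q)) \<le> (\<Sum>t=1..card A. measure M (U t))"
    and "(\<Sum>t=1..card A. measure M {u \<in> P. \<exists>a\<in>A. \<phi> a u \<in> U t})
          \<le> (\<Sum>t=1..card A. measure M (T t))"
proof -
  define F where "F = img S - img Q"
  define T where "T t = {v \<in> S. t \<le> card {a \<in> A. v \<in> \<phi> a ` P}}" for t
  define U where "U t = {v \<in> S. t \<le> card {b \<in> A. \<phi> b v \<in> F}}" for t
  have S: "S \<in> fmeasurable M"
    unfolding S_def using P Q by (auto intro: fmeasurable_Diff)
  have F: "F \<in> fmeasurable M"
    unfolding F_def using S Q by (auto intro: fmeasurable_Diff)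
  have sets: "P \<in> sets M" "Q \<in> sets M" "S \<in> sets M" "F \<in> sets M"
    using P Q S F by (auto simp: fmeasurable_def)
  have sub: "P \<subseteq> space M" "S \<subseteq> space M"
    using sets sets.sets_into_space by auto
  have finc: "finite {a \<in> A. R a}" for R
    using finite_A by simp
  have Tm: "T t \<in> fmeasurable M" for t
    unfolding T_def using finite_A S image_map_sets sets
    by (intro count_level_set_fmeasurable) auto
  have Um: "U t \<in> fmeasurable M" for t
  proof -
    have "U t = {v \<in> S. t \<le> card {b \<in> A. v \<in> {y \<in> S. \<phi> b y \<in> F}}}"
      unfolding U_def by (auto cong: conj_cong)
    then show ?thesis
      using count_level_set_fmeasurable[OF finite_A S, of "\<lambda>b. {y \<in> S. \<phi> b y \<in> F}" t]
        vimage_map_fmeasurable[OF _ S, of _ F] sets by (simp add: fmeasurable_def)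
  qed
  have Em: "{u \<in> P. \<exists>a\<in>A. \<phi> a u \<in> U t} \<in> fmeasurable M" for t
    using P Um by (intro vimage_union_fmeasurable) (auto dest: fmeasurableD)
  \<comment> \<open>The parallelogram with vertices \<open>u\<close>, \<open>\<phi> a u\<close>, \<open>\<phi> b u\<close> and \<open>\<phi> b (\<phi> a u)\<close>: the vertex
      \<open>\<phi> b u\<close> is not in \<open>Q\<close>, since otherwise the last vertex would be in \<open>img Q\<close>.\<close>
  have square: "\<phi> b u \<in> S" if "u \<in> P" "a \<in> A" "b \<in> A" "\<phi> b (\<phi> a u) \<in> F" for a b u
  proof -
    have "\<phi> b (\<phi> a u) = \<phi> a (\<phi> b u)"
      using that sub by (auto intro: commute)
    then have "\<phi> b u \<notin> Q"
      using that by (auto simp: F_def act_set_def)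
    then show ?thesis
      using that by (auto simp: S_def act_set_def)
  qed
  have T1: "T 1 = S"
  proof -
    have "1 \<le> card {a \<in> A. v \<in> \<phi> a ` P}" if v: "v \<in> S" for v
    proof -
      have "{a \<in> A. v \<in> \<phi> a ` P} \<noteq> {}"
        using v by (auto simp: S_def act_set_def)
      then show ?thesis
        using finc card_gt_0_iff by (metis One_nat_def Suc_leI)
    qed
    then show ?thesis
      by (auto simp: T_def)
  qed
  \<comment> \<open>A point of degree \<open>n\<close> lies in exactly \<open>n\<close> of the level sets.\<close>
  have card_levels: "card {t \<in> {1..card A}. t \<le> n} = n" if "n \<le> card A" for n
  proof -
    have "{t \<in> {1..card A}. t \<le> n} = {1..n}"
      using that by auto
    then show ?thesis by simp
  qed
  have cardA: "card {a \<in> A. R a} \<le> card A" for R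
    using finite_A by (auto intro: card_mono)
  have "(\<Sum>t=1..card A. measure M (img (T t) - img Q)) \<le> (\<Sum>a\<in>A. measure M (F \<inter> \<phi> a ` S))"
  proof (rule sum_measure_le_of_count_le)
    fix w
    have "t \<le> card {a \<in> A. w \<in> F \<inter> \<phi> a ` S}" if w: "w \<in> img (T t) - img Q" for t
    proof -
      obtain b v where bv: "b \<in> A" "v \<in> T t" "w = \<phi> b v"
        using w by (auto simp: act_set_def)
      have wF: "w \<in> F"
        using w img_mono[of "T t" S] by (auto simp: F_def T_def)
      \<comment> \<open>The labels of edges into \<open>v\<close> are also labels of edges into \<open>w\<close>.\<close>
      have "{a \<in> A. v \<in> \<phi> a ` P} \<subseteq> {a \<in> A. w \<in> F \<inter> \<phi> a ` S}"
      proof safe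
        fix a u assume au: "a \<in> A" "u \<in> P" "v = \<phi> a u"
        then have "\<phi> b u \<in> S" "w = \<phi> a (\<phi> b u)"
          using square[of u a b] bv wF commute[of b a u] sub by auto
        then show "w \<in> \<phi> a ` S" by blast
      qed (rule wF)
      then have "card {a \<in> A. v \<in> \<phi> a ` P} \<le> card {a \<in> A. w \<in> F \<inter> \<phi> a ` S}"
        by (intro card_mono finc)
      then show ?thesis
        using bv by (simp add: T_def)
    qed
    then have "{t \<in> {1..card A}. w \<in> img (T t) - img Q} \<subseteq> {1..card {a \<in> A. w \<in> F \<inter> \<phi> a ` S}}"
      by auto
    from card_mono[OF finite_atLeastAtMost this]
    show "card {t \<in> {1..card A}. w \<in> img (T t) - img Q} \<le> card {a \<in> A. w \<in> F \<inter> \<phi> a ` S}"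
      by simp
  qed (use Tm Q F sets finite_A image_map_fmeasurable[OF _ S] in
      \<open>auto intro!: fmeasurable_Diff fmeasurable.Int dest: fmeasurableD\<close>)
  also have "\<dots> = (\<Sum>b\<in>A. measure M {v \<in> S. \<phi> b v \<in> F})"
    using S sets by (intro sum.cong measure_Int_image_map) auto
  also have "\<dots> \<le> (\<Sum>t=1..card A. measure M (U t))"
  proof (rule sum_measure_le_of_count_le)
    fix v
    show "card {b \<in> A. v \<in> {v \<in> S. \<phi> b v \<in> F}} \<le> card {t \<in> {1..card A}. v \<in> U t}"
    proof (cases "v \<in> S")
      case True
      then show ?thesis
        using card_levels[OF cardA[of "\<lambda>b. \<phi> b v \<in> F"]] by (simp add: U_def)
    qed simp
  qed (use S sets finite_A Um in \<open>auto intro: vimage_map_fmeasurable\<close>)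
  finally have 1: "(\<Sum>t=1..card A. measure M (img (T t) - img Q)) \<le> (\<Sum>t=1..card A. measure M (U t))" .
  have "(\<Sum>t=1..card A. measure M {u \<in> P. \<exists>a\<in>A. \<phi> a u \<in> U t})
      \<le> (\<Sum>b\<in>A. measure M {u \<in> P. \<phi> b u \<in> S})"
  proof (rule sum_measure_le_of_count_le)
    fix u
    have "t \<le> card {b \<in> A. u \<in> {u \<in> P. \<phi> b u \<in> S}}"
      if u: "u \<in> P" "a \<in> A" "\<phi> a u \<in> U t" for t a
    proof -
      \<comment> \<open>The labels of edges out of \<open>\<phi> a u\<close> are also labels of edges out of \<open>u\<close>.\<close>
      have "{b \<in> A. \<phi> b (\<phi> a u) \<in> F} \<subseteq> {b \<in> A. u \<in> {u \<in> P. \<phi> b u \<in> S}}"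
        using square[of u a] u by auto
      then have "card {b \<in> A. \<phi> b (\<phi> a u) \<in> F} \<le> card {b \<in> A. u \<in> {u \<in> P. \<phi> b u \<in> S}}"
        by (intro card_mono finc)
      then show ?thesis
        using u by (simp add: U_def)
    qed
    then have "{t \<in> {1..card A}. u \<in> {u \<in> P. \<exists>a\<in>A. \<phi> a u \<in> U t}}
        \<subseteq> {1..card {b \<in> A. u \<in> {u \<in> P. \<phi> b u \<in> S}}}"
      by auto
    from card_mono[OF finite_atLeastAtMost this]
    show "card {t \<in> {1..card A}. u \<in> {u \<in> P. \<exists>a\<in>A. \<phi> a u \<in> U t}}
        \<le> card {b \<in> A. u \<in> {u \<in> P. \<phi> b u \<in> S}}"
      by simp
  qed (use P sets finite_A Em in \<open>auto intro: vimage_map_fmeasurable\<close>)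
  also have "\<dots> = (\<Sum>b\<in>A. measure M (S \<inter> \<phi> b ` P))"
    using P sets by (intro sum.cong measure_Int_image_map[symmetric]) auto
  also have "\<dots> \<le> (\<Sum>t=1..card A. measure M (T t))"
  proof (rule sum_measure_le_of_count_le)
    fix v
    show "card {b \<in> A. v \<in> S \<inter> \<phi> b ` P} \<le> card {t \<in> {1..card A}. v \<in> T t}"
    proof (cases "v \<in> S")
      case True
      then show ?thesis
        using card_levels[OF cardA[of "\<lambda>b. v \<in> \<phi> b ` P"]] by (simp add: T_def)
    qed simp
  qed (use S sets finite_A Tm image_map_fmeasurable[OF _ P] in
      \<open>auto intro!: fmeasurable.Int\<close>)
  finally have 2: "(\<Sum>t=1..card A. measure M {u \<in> P. \<exists>a\<in>A. \<phi> a u \<in> U t})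
      \<le> (\<Sum>t=1..card A. measure M (T t))" .
  show thesis
    by (rule that[OF T1 Tm _ Um _ 1 2]) (auto simp: T_def U_def)
qed

section \<open>Weighted cuts\<close>

primrec boundary :: "'x set \<Rightarrow> (nat \<Rightarrow> 'x set) \<Rightarrow> nat \<Rightarrow> 'x set"
  where
    "boundary B R 0 = B - R 0"
  | "boundary B R (Suc i) = img (R i) - R (Suc i)"

definition cost :: "real \<Rightarrow> nat \<Rightarrow> 'x set \<Rightarrow> (nat \<Rightarrow> 'x set) \<Rightarrow> real"
  where "cost C h B R = (\<Sum>i\<le>h. measure M (boundary B R i) / C ^ i)"

text \<open>A set \<open>R (Suc i)\<close> may contain points outside \<open>img (R i)\<close>, which can only enlarge the next
  boundary.  This freedom makes it possible to change one set of the sequence and keep the others.\<close>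

definition admissible :: "nat \<Rightarrow> 'x set \<Rightarrow> (nat \<Rightarrow> 'x set) \<Rightarrow> bool"
  where "admissible h B R \<longleftrightarrow> R 0 \<subseteq> B \<and> (\<forall>i. R i \<in> fmeasurable M) \<and> R h = {}"

lemma boundary_fmeasurable:
  assumes "B \<in> fmeasurable M" "admissible h B R"
  shows "boundary B R i \<in> fmeasurable M"
  using assms by (cases i) (auto simp: admissible_def intro!: fmeasurable_Diff dest: fmeasurableD)

lemma cost_nonneg: "0 < C \<Longrightarrow> 0 \<le> cost C h B R"
  unfolding cost_def by (intro sum_nonneg) simp

lemma boundary_update:
  "i \<noteq> k \<Longrightarrow> i \<noteq> Suc k \<Longrightarrow> boundary B (R(k := Y)) i = boundary B R i"
  by (cases i) auto

lemma cost_update: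
  assumes "k < h"
  shows "cost C h B (R(k := Y)) = cost C h B R
    + (measure M (boundary B (R(k := Y)) k) - measure M (boundary B R k)) / C ^ k
    + (measure M (boundary B (R(k := Y)) (Suc k)) - measure M (boundary B R (Suc k))) / C ^ Suc k"
proof -
  have "cost C h B (R(k := Y)) - cost C h B R
      = (\<Sum>i\<le>h. (measure M (boundary B (R(k := Y)) i) - measure M (boundary B R i)) / C ^ i)"
    by (simp add: cost_def sum_subtractf diff_divide_distrib)
  also have "\<dots> = (\<Sum>i\<in>{k, Suc k}. (measure M (boundary B (R(k := Y)) i) - measure M (boundary B R i)) / C ^ i)"
    using assms boundary_update by (intro sum.mono_neutral_right) auto
  finally show ?thesis
    by simp
qed

text \<open>Adding \<open>T\<close> to the source side removes \<open>T\<close> from the cut and puts the newly reached points of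
  the next layer into it.\<close>

lemma push:
  assumes C: "0 < C" and B: "B \<in> fmeasurable M" and k: "Suc k < h" and R: "admissible h B R"
    and T: "T \<in> fmeasurable M" "T \<subseteq> boundary B R (Suc k)"
  defines "R' \<equiv> R(Suc k := R (Suc k) \<union> T)"
  shows "admissible h B R'"
    and "cost C h B R' \<le> cost C h B R
      + (measure M (img T - img (R (Suc k))) - C * measure M T) / C ^ Suc (Suc k)"
proof -
  show adm: "admissible h B R'"
    using R T k by (auto simp: admissible_def R'_def)
  have bd: "boundary B R i \<in> fmeasurable M" "boundary B R' i \<in> fmeasurable M" for i
    using boundary_fmeasurable[OF B] R adm by auto
  have "boundary B R' (Suc k) = boundary B R (Suc k) - T"
    by (auto simp: R'_def)
  then have 1: "measure M (boundary B R' (Suc k)) = measure M (boundary B R (Suc k)) - measure M T"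
    using T bd by (simp add: measurable_measure_Diff fmeasurableD del: boundary.simps)
  have F: "img T - img (R (Suc k)) \<in> fmeasurable M"
    using T img_fmeasurable[of "R (Suc k)"] R
    by (auto simp: admissible_def intro!: fmeasurable_Diff dest: fmeasurableD)
  have "boundary B R' (Suc (Suc k)) \<subseteq> boundary B R (Suc (Suc k)) \<union> (img T - img (R (Suc k)))"
    by (auto simp: R'_def img_Un)
  then have "measure M (boundary B R' (Suc (Suc k)))
      \<le> measure M (boundary B R (Suc (Suc k)) \<union> (img T - img (R (Suc k))))"
    using bd F by (intro measure_mono_fmeasurable) (auto dest: fmeasurableD simp del: boundary.simps)
  also have "\<dots> \<le> measure M (boundary B R (Suc (Suc k))) + measure M (img T - img (R (Suc k)))"
    using bd F by (intro measure_Un_le) (auto dest: fmeasurableD simp del: boundary.simps)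
  finally have 2: "(measure M (boundary B R' (Suc (Suc k))) - measure M (boundary B R (Suc (Suc k)))) / C ^ Suc (Suc k)
      \<le> measure M (img T - img (R (Suc k))) / C ^ Suc (Suc k)"
    using C by (intro divide_right_mono) auto
  have 3: "measure M T / C ^ Suc k = C * measure M T / C ^ Suc (Suc k)"
    using C by simp
  show "cost C h B R' \<le> cost C h B R
      + (measure M (img T - img (R (Suc k))) - C * measure M T) / C ^ Suc (Suc k)"
    using cost_update[OF k, of C B R "R (Suc k) \<union> T"] 2 3
    unfolding R'_def[symmetric] 1 by (simp add: diff_divide_distrib del: boundary.simps power_Suc)
qed

text \<open>Removing all in-neighbours of \<open>U\<close> from the source side puts them into the cut at worst, and
  \<open>U\<close>, which is no longer reached, drops out of it.\<close>

lemma pull: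
  assumes C: "0 < C" and B: "B \<in> fmeasurable M" and k: "k < h" and R: "admissible h B R"
    and U: "U \<in> fmeasurable M" "U \<subseteq> boundary B R (Suc k)"
  defines "E \<equiv> {u \<in> R k. \<exists>a\<in>A. \<phi> a u \<in> U}"
  defines "R' \<equiv> R(k := R k - E)"
  shows "admissible h B R'"
    and "cost C h B R' \<le> cost C h B R + (C * measure M E - measure M U) / C ^ Suc k"
proof -
  have E: "E \<in> fmeasurable M"
    unfolding E_def using R U
    by (auto intro!: vimage_union_fmeasurable simp: admissible_def dest: fmeasurableD)
  show adm: "admissible h B R'"
    using R E k by (auto simp: admissible_def R'_def intro!: fmeasurable_Diff dest: fmeasurableD)
  have bd: "boundary B R i \<in> fmeasurable M" "boundary B R' i \<in> fmeasurable M" for i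
    using boundary_fmeasurable[OF B] R adm by auto
  have "boundary B R' (Suc k) \<subseteq> boundary B R (Suc k) - U"
    by (auto simp: R'_def E_def act_set_def)
  then have "measure M (boundary B R' (Suc k)) \<le> measure M (boundary B R (Suc k) - U)"
    using bd U by (intro measure_mono_fmeasurable)
      (auto intro!: fmeasurable_Diff dest: fmeasurableD simp del: boundary.simps)
  also have "\<dots> = measure M (boundary B R (Suc k)) - measure M U"
    using U bd by (simp add: measurable_measure_Diff fmeasurableD del: boundary.simps)
  finally have 1: "(measure M (boundary B R' (Suc k)) - measure M (boundary B R (Suc k))) / C ^ Suc k
      \<le> - measure M U / C ^ Suc k"
    using C by (intro divide_right_mono) auto
  have "boundary B R' k \<subseteq> boundary B R k \<union> E"
    by (cases k) (auto simp: R'_def)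
  then have "measure M (boundary B R' k) \<le> measure M (boundary B R k \<union> E)"
    using bd E by (intro measure_mono_fmeasurable) (auto dest: fmeasurableD)
  also have "\<dots> \<le> measure M (boundary B R k) + measure M E"
    using bd E by (intro measure_Un_le) (auto dest: fmeasurableD)
  finally have 2: "(measure M (boundary B R' k) - measure M (boundary B R k)) / C ^ k
      \<le> measure M E / C ^ k"
    using C by (intro divide_right_mono) auto
  have 3: "measure M E / C ^ k = C * measure M E / C ^ Suc k"
    using C by simp
  show "cost C h B R' \<le> cost C h B R + (C * measure M E - measure M U) / C ^ Suc k"
    using cost_update[OF k, of C B R "R k - E"] 1 2 3
    unfolding R'_def[symmetric] by (simp add: diff_divide_distrib del: boundary.simps power_Suc)
qed

section \<open>Moving a nearly minimal cut to the outer layers\<close>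

text \<open>The lemmas \<open>push\<close> and \<open>pull\<close> bound the change of cost when some \<open>T t\<close> is pushed or some
  \<open>U t\<close> is pulled.  By \<open>degree_level_sets\<close> the bounds for all these pushes and pulls, those
  for the pulls scaled by \<open>1 / C\<close>, have a sum of at most \<open>0\<close>.  For a nearly minimal cut each
  bound is at least \<open>- \<epsilon>\<close> before scaling.  So none of them can be much larger than \<open>0\<close>, and in
  particular not the one for the push of \<open>T 1\<close>, which is the entire boundary in this layer.\<close>

lemma push_near_minimal:
  assumes C: "0 < C" and B: "B \<in> fmeasurable M" and k: "Suc k < h" and R: "admissible h B R"
    and m: "\<And>R. admissible h B R \<Longrightarrow> m \<le> cost C h B R"
    and near: "cost C h B R \<le> m + \<epsilon>"
  shows "cost C h B (R(Suc k := R (Suc k) \<union> boundary B R (Suc k)))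
    \<le> m + (1 + real (card A) + real (card A) / C) * \<epsilon>"
proof -
  define S where "S = boundary B R (Suc k)"
  define W where "W = C ^ Suc (Suc k)"
  define f where "f T = measure M (img T - img (R (Suc k)))" for T
  define e where "e U = measure M {u \<in> R k. \<exists>a\<in>A. \<phi> a u \<in> U}" for U
  have W: "0 < W"
    using C by (simp add: W_def)
  have PQ: "R k \<in> fmeasurable M" "R (Suc k) \<in> fmeasurable M"
    using R by (auto simp: admissible_def)
  have \<epsilon>: "0 \<le> \<epsilon>"
    using m[OF R] near by simp
  have S_eq: "img (R k) - R (Suc k) = S"
    by (simp add: S_def)
  obtain T U :: "nat \<Rightarrow> 'x set"
    where T1: "T 1 = S"
      and T: "\<And>t. T t \<in> fmeasurable M" "\<And>t. T t \<subseteq> S"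
      and U: "\<And>t. U t \<in> fmeasurable M" "\<And>t. U t \<subseteq> S"
      and fU: "(\<Sum>t=1..card A. f (T t)) \<le> (\<Sum>t=1..card A. measure M (U t))"
      and eT: "(\<Sum>t=1..card A. e (U t)) \<le> (\<Sum>t=1..card A. measure M (T t))"
    by (rule degree_level_sets[OF PQ, unfolded S_eq, folded f_def e_def]) (rule that)
  have lowT: "- (\<epsilon> * W) \<le> f (T t) - C * measure M (T t)" for t
  proof -
    have "m \<le> cost C h B R + (f (T t) - C * measure M (T t)) / W"
      using push[OF C B k R T(1) T(2)[unfolded S_def]] m unfolding f_def W_def by (meson order_trans)
    then have "- \<epsilon> \<le> (f (T t) - C * measure M (T t)) / W"
      using near by linarith
    then have "- \<epsilon> * W \<le> f (T t) - C * measure M (T t)"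
      using W by (subst (asm) pos_le_divide_eq) auto
    then show ?thesis
      by simp
  qed
  have lowU: "- (\<epsilon> * W / C) \<le> C * e (U t) - measure M (U t)" for t
  proof -
    have "m \<le> cost C h B R + (C * e (U t) - measure M (U t)) / C ^ Suc k"
      using pull[OF C B Suc_lessD[OF k] R U(1) U(2)[unfolded S_def]] m
      unfolding e_def by (meson order_trans)
    then have "- \<epsilon> \<le> (C * e (U t) - measure M (U t)) / C ^ Suc k"
      using near by linarith
    then have "- \<epsilon> * C ^ Suc k \<le> C * e (U t) - measure M (U t)"
      using C by (subst (asm) pos_le_divide_eq) auto
    moreover have "\<epsilon> * W / C = \<epsilon> * C ^ Suc k"
      using C by (simp add: W_def)
    ultimately show ?thesis by simp
  qed
  have upT: "f S - C * measure M S \<le> (real (card A) + real (card A) / C) * \<epsilon> * W"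
  proof (cases "A = {}")
    case True
    then have "img (R k) = {}"
      by (simp add: act_set_def)
    then have "S = {}"
      using S_eq by simp
    then show ?thesis
      using True by (simp add: f_def act_set_def)
  next
    case False
    then have n: "1 \<in> {1..card A}"
      using finite_A by (simp add: Suc_le_eq card_gt_0_iff)
    \<comment> \<open>All summands on the right are nonnegative by \<open>lowT\<close>.\<close>
    have "f (T 1) - C * measure M (T 1) + \<epsilon> * W
        \<le> (\<Sum>t=1..card A. f (T t) - C * measure M (T t) + \<epsilon> * W)"
      using lowT by (intro member_le_sum[OF n]) (auto simp: algebra_simps)
    also have "\<dots> = (\<Sum>t=1..card A. f (T t)) - C * (\<Sum>t=1..card A. measure M (T t)) + card A * (\<epsilon> * W)"
      by (simp add: sum.distrib sum_subtractf sum_distrib_left)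
    also have "\<dots> \<le> (\<Sum>t=1..card A. measure M (U t)) - C * (\<Sum>t=1..card A. e (U t)) + card A * (\<epsilon> * W)"
      using fU mult_left_mono[OF eT, of C] C by linarith
    also have "\<dots> = (\<Sum>t=1..card A. measure M (U t) - C * e (U t)) + card A * (\<epsilon> * W)"
      by (simp add: sum_subtractf sum_distrib_left)
    also have "(\<Sum>t=1..card A. measure M (U t) - C * e (U t)) \<le> (\<Sum>t=1..card A. \<epsilon> * W / C)"
      using lowU by (intro sum_mono) (simp add: algebra_simps)
    finally have "f S - C * measure M S + \<epsilon> * W \<le> card A * (\<epsilon> * W / C) + card A * (\<epsilon> * W)"
      by (simp add: T1[unfolded One_nat_def])
    moreover have "0 \<le> \<epsilon> * W"
      using \<epsilon> W by simp
    ultimately show ?thesis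
      by (simp add: algebra_simps)
  qed
  have "cost C h B (R(Suc k := R (Suc k) \<union> S)) \<le> cost C h B R + (f S - C * measure M S) / W"
    using push(2)[OF C B k R, of S] boundary_fmeasurable[OF B R] unfolding f_def W_def S_def by blast
  also have "(f S - C * measure M S) / W \<le> (real (card A) + real (card A) / C) * \<epsilon>"
    using upT W by (simp add: pos_divide_le_eq)
  finally show ?thesis
    using near by (simp add: S_def algebra_simps)
qed

text \<open>Pushing at layer \<open>Suc k\<close> leaves the boundary in the layers before it unchanged, so the layers
  can be emptied in increasing order.  Each step multiplies the error by the constant \<open>L\<close>, which
  is made up for by starting with a smaller one.\<close>

lemma near_minimal_with_empty_middle:
  assumes C: "0 < C" and B: "B \<in> fmeasurable M" and k: "k < h" and \<epsilon>: "0 < \<epsilon>"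
    and m: "m = Inf (cost C h B ` {R. admissible h B R})"
  shows "\<exists>R. admissible h B R \<and> cost C h B R \<le> m + \<epsilon> \<and> (\<forall>i<k. boundary B R (Suc i) = {})"
  using k \<epsilon>
proof (induction k arbitrary: \<epsilon>)
  case 0
  have "admissible h B (\<lambda>_. {})"
    by (simp add: admissible_def)
  then have "cost C h B ` {R. admissible h B R} \<noteq> {}"
    by blast
  then obtain x where "x \<in> cost C h B ` {R. admissible h B R}" "x < m + \<epsilon>"
    using 0 cInf_lessD[of "cost C h B ` {R. admissible h B R}" "m + \<epsilon>"] unfolding m by auto
  then show ?case
    by (auto intro!: less_imp_le)
next
  case (Suc k)
  define L where "L = 1 + real (card A) + real (card A) / C"
  have L: "0 < L"
    using C by (simp add: L_def add_pos_nonneg)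
  have low: "m \<le> cost C h B R" if "admissible h B R" for R
    unfolding m using that cost_nonneg[OF C] by (intro cInf_lower bdd_belowI[of _ 0]) auto
  obtain R where R: "admissible h B R" "cost C h B R \<le> m + \<epsilon> / L"
      "\<forall>i<k. boundary B R (Suc i) = {}"
    using Suc.IH[of "\<epsilon> / L"] Suc.prems L by auto
  let ?R = "R(Suc k := R (Suc k) \<union> boundary B R (Suc k))"
  have "cost C h B ?R \<le> m + L * (\<epsilon> / L)"
    unfolding L_def[abs_def] by (rule push_near_minimal[OF C B Suc.prems(1) R(1) low R(2)[unfolded L_def]])
  then have "cost C h B ?R \<le> m + \<epsilon>"
    using L by simp
  moreover have "admissible h B ?R"
    using push(1)[OF C B Suc.prems(1) R(1) boundary_fmeasurable[OF B R(1)]] by blast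
  moreover have "boundary B ?R (Suc i) = {}" if "i < Suc k" for i
  proof (cases "i = k")
    case False
    then show ?thesis
      using R(3) that by (subst boundary_update) auto
  qed auto
  ultimately show ?case
    by (intro exI[of _ ?R] conjI allI impI)
qed

lemma funpow_img_fmeasurable: "Z \<in> fmeasurable M \<Longrightarrow> (img ^^ i) Z \<in> fmeasurable M"
  by (induction i) (simp_all add: img_fmeasurable)

text \<open>If the boundary is empty in the intermediate layers, then \<open>R i\<close> contains everything that is
  reached from \<open>R 0\<close>.  So \<open>(img ^^ h) (R 0)\<close> lies in the last boundary, and by the growth
  assumption its cost makes up for the part \<open>R 0\<close> of \<open>B\<close> that is missing from the first one.\<close>

lemma cost_ge_measure:
  assumes C: "0 < C" and B: "B \<in> fmeasurable M" and h: "0 < h"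
    and growth: "\<And>Z. Z \<in> sets M \<Longrightarrow> Z \<subseteq> B \<Longrightarrow> C ^ h * measure M Z \<le> measure M ((img ^^ h) Z)"
    and R: "admissible h B R"
  shows "measure M B \<le> cost C h B R"
proof -
  define m where "m = Inf (cost C h B ` {R. admissible h B R})"
  have "measure M B \<le> m + \<epsilon>" if \<epsilon>: "0 < \<epsilon>" for \<epsilon>
  proof -
    obtain n where n: "h = Suc n"
      using h by (cases h) auto
    then have "n < h"
      by simp
    from near_minimal_with_empty_middle[OF C B this \<epsilon> m_def]
    obtain R where R: "admissible h B R" "cost C h B R \<le> m + \<epsilon>"
        "\<forall>i<n. boundary B R (Suc i) = {}"
      by (elim exE conjE)
    have "(img ^^ i) (R 0) \<subseteq> R i" if "i \<le> n" for i
      using that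
    proof (induction i)
      case (Suc i)
      then have "img (R i) \<subseteq> R (Suc i)" "img ((img ^^ i) (R 0)) \<subseteq> img (R i)"
        using R(3) by (simp_all add: img_mono)
      then show ?case
        by simp
    qed simp
    then have "(img ^^ h) (R 0) \<subseteq> boundary B R h"
      using R(1) img_mono[of "(img ^^ n) (R 0)" "R n"] by (auto simp: n admissible_def)
    moreover have R0: "R 0 \<in> fmeasurable M" "R 0 \<subseteq> B"
      using R(1) by (auto simp: admissible_def)
    ultimately have "measure M ((img ^^ h) (R 0)) \<le> measure M (boundary B R h)"
      using boundary_fmeasurable[OF B R(1)] funpow_img_fmeasurable
      by (intro measure_mono_fmeasurable) (auto dest: fmeasurableD)
    then have "C ^ h * measure M (R 0) \<le> measure M (boundary B R h)"
      using growth[of "R 0"] R0 by (auto dest: fmeasurableD)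
    then have "measure M (R 0) \<le> measure M (boundary B R h) / C ^ h"
      using C by (simp add: field_simps)
    moreover have "measure M (boundary B R 0) = measure M B - measure M (R 0)"
      using B R0 by (simp add: measurable_measure_Diff fmeasurableD)
    moreover have "(\<Sum>i\<in>{0, h}. measure M (boundary B R i) / C ^ i) \<le> cost C h B R"
      unfolding cost_def using C by (intro sum_mono2) auto
    ultimately show ?thesis
      using R(2) h by simp
  qed
  then have "measure M B \<le> m"
    by (rule field_le_epsilon)
  also have "m \<le> cost C h B R"
    unfolding m_def using R cost_nonneg[OF C] by (intro cInf_lower bdd_belowI[of _ 0]) auto
  finally show ?thesis .
qed

text \<open>Pluennecke's inequality in terms of the maps: \<open>cost_ge_measure\<close> is applied to the cut that
  lets \<open>Z\<close> spread freely and stops it in layer \<open>j\<close>.\<close>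

lemma growth_at_intermediate_level:
  assumes C: "0 < C" and B: "B \<in> fmeasurable M" and j: "0 < j" "j \<le> h"
    and growth: "\<And>Z. Z \<in> sets M \<Longrightarrow> Z \<subseteq> B \<Longrightarrow> C ^ h * measure M Z \<le> measure M ((img ^^ h) Z)"
    and Z: "Z \<in> sets M" "Z \<subseteq> B"
  shows "C ^ j * measure M Z \<le> measure M ((img ^^ j) Z)"
proof -
  define R where "R i = (if i < j then (img ^^ i) Z else {})" for i
  have Zf: "Z \<in> fmeasurable M"
    using fmeasurableI2[OF B] Z by blast
  have "admissible h B R"
    using j Z funpow_img_fmeasurable[OF Zf] by (auto simp: admissible_def R_def)
  then have "measure M B \<le> cost C h B R"
    using cost_ge_measure[OF C B _ growth] j by simp
  also have "cost C h B R = (\<Sum>i\<in>{0, j}. measure M (boundary B R i) / C ^ i)"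
    unfolding cost_def
  proof (rule sum.mono_neutral_right)
    show "\<forall>i\<in>{..h} - {0, j}. measure M (boundary B R i) / C ^ i = 0"
    proof
      fix i assume "i \<in> {..h} - {0, j}"
      then have "boundary B R i = {}"
        by (cases i) (auto simp: R_def)
      then show "measure M (boundary B R i) / C ^ i = 0"
        by simp
    qed
  qed (use j in auto)
  also have "\<dots> = measure M (boundary B R 0) + measure M (boundary B R j) / C ^ j"
    using j by simp
  also have "boundary B R j = (img ^^ j) Z"
    using j by (cases j) (auto simp: R_def)
  also have "measure M (boundary B R 0) = measure M B - measure M Z"
    using j B Z by (simp add: R_def measurable_measure_Diff fmeasurableD)
  finally show ?thesis
    using C by (simp add: field_simps)
qed

end

section \<open>Actions of abelian groups\<close>

context measure_action
begin

lemma set_power_subset_carrier: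
  assumes "A \<subseteq> carrier G"
  shows "set_power G A k \<subseteq> carrier G"
proof -
  interpret group G
    using group_hom by (simp add: group_hom_def)
  show ?thesis
    using assms by (induction k) (auto simp: set_mult_def)
qed

lemma finite_set_power: "finite A \<Longrightarrow> finite (set_power G A k)"
  by (induction k) (auto simp: set_mult_def)

lemma act_set_set_power:
  assumes A: "A \<subseteq> carrier G" and comm: "comm_group G" and Z: "Z \<subseteq> space M"
  shows "act_set \<phi> (set_power G A k) Z = (act_set \<phi> A ^^ k) Z"
proof (induction k)
  case 0
  have "\<phi> \<one> z = z" if "z \<in> Z" for z
    using that Z id_eq_one by (metis restrict_apply' subsetD)
  then show ?case
    by (force simp: act_set_def)
next
  case (Suc k)
  have comp: "\<phi> (b \<otimes> a) z = \<phi> a (\<phi> b z)" if "b \<in> set_power G A k" "a \<in> A" "z \<in> Z" for a b z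
  proof -
    have "b \<in> carrier G" "a \<in> carrier G" "z \<in> space M"
      using that A Z set_power_subset_carrier[OF A] by auto
    then show ?thesis
      using composition_rule[of z a b] comm_groupE(4)[OF comm, of a b] by simp
  qed
  have "act_set \<phi> (set_power G A (Suc k)) Z = act_set \<phi> A (act_set \<phi> (set_power G A k) Z)"
  proof (intro subset_antisym subsetI)
    fix y assume "y \<in> act_set \<phi> (set_power G A (Suc k)) Z"
    then obtain a b z where "b \<in> set_power G A k" "a \<in> A" "z \<in> Z" "y = \<phi> (b \<otimes> a) z"
      by (auto simp: act_set_def set_mult_def)
    then show "y \<in> act_set \<phi> A (act_set \<phi> (set_power G A k) Z)"
      unfolding act_set_def using comp by blast
  next
    fix y assume "y \<in> act_set \<phi> A (act_set \<phi> (set_power G A k) Z)"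
    then obtain a b z where *: "b \<in> set_power G A k" "a \<in> A" "z \<in> Z" "y = \<phi> a (\<phi> b z)"
      by (auto simp: act_set_def)
    then have "b \<otimes> a \<in> set_power G A (Suc k)"
      by (auto simp: set_mult_def)
    moreover have "y = \<phi> (b \<otimes> a) z"
      using * comp by simp
    ultimately show "y \<in> act_set \<phi> (set_power G A (Suc k)) Z"
      unfolding act_set_def using *(3) by blast
  qed
  then show ?case
    by (simp add: Suc.IH)
qed

lemma commuting_measure_maps:
  assumes "comm_group G" "A \<subseteq> carrier G" "finite A"
  shows "commuting_measure_maps M \<phi> A"
proof
  fix a b x assume x: "a \<in> A" "b \<in> A" "x \<in> space M"
  then have ab: "a \<in> carrier G" "b \<in> carrier G"
    using assms(2) by auto
  show "\<phi> a (\<phi> b x) = \<phi> b (\<phi> a x)"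
    using composition_rule[OF x(3) ab] composition_rule[OF x(3) ab(2,1)]
      comm_groupE(4)[OF assms(1) ab] by simp
qed (use assms action_measurable action_emeasure image_sets in auto)

lemma act_set_fmeasurable:
  assumes "finite A" "A \<subseteq> carrier G" "Z \<in> fmeasurable M"
  shows "act_set \<phi> A Z \<in> fmeasurable M"
proof -
  have "act_set \<phi> A Z = (\<Union>a\<in>A. \<phi> a ` Z)"
    by (auto simp: act_set_def)
  moreover have "\<phi> a ` Z \<in> fmeasurable M" if "a \<in> A" for a
    using assms that action_emeasure[of a Z] image_sets[of a Z] by (auto simp: fmeasurable_def)
  ultimately show ?thesis
    using assms by (auto intro!: fmeasurable.finite_UN)
qed

text \<open>Null sets \<open>Z\<close>, over which the infimum does not range, satisfy the inequality on the right
  trivially, and all measures involved are finite, so that the ratio of extended nonnegative reals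
  is a ratio of real numbers.\<close>

lemma le_magnification_ratio_iff:
  assumes A: "finite A" "A \<subseteq> carrier G"
    and B: "B \<in> sets M" "0 < emeasure M B" "emeasure M B < \<infinity>" and c: "0 \<le> c"
  shows "c \<le> enn2real (magnification_ratio M \<phi> A B)
    \<longleftrightarrow> (\<forall>Z\<in>sets M. Z \<subseteq> B \<longrightarrow> c * measure M Z \<le> measure M (act_set \<phi> A Z))"
proof -
  have fin: "Z \<in> fmeasurable M" if "Z \<in> sets M" "Z \<subseteq> B" for Z
    using fmeasurableI2[of B M Z] that B by (simp add: fmeasurable_def)
  have ratio: "ennreal c \<le> emeasure M (act_set \<phi> A Z) / emeasure M Z
      \<longleftrightarrow> c * measure M Z \<le> measure M (act_set \<phi> A Z)"
    if Z: "Z \<in> sets M" "Z \<subseteq> B" "0 < emeasure M Z" for Z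
  proof -
    have "emeasure M Z = ennreal (measure M Z)"
        "emeasure M (act_set \<phi> A Z) = ennreal (measure M (act_set \<phi> A Z))"
      using fin[OF Z(1,2)] act_set_fmeasurable[OF A fin[OF Z(1,2)]]
      by (auto simp: emeasure_eq_measure2)
    moreover from this have "0 < measure M Z"
      using Z(3) by (simp add: ennreal_less_zero_iff)
    ultimately show ?thesis
      by (simp add: divide_ennreal pos_le_divide_eq)
  qed
  have "c \<le> enn2real (magnification_ratio M \<phi> A B)
      \<longleftrightarrow> ennreal c \<le> magnification_ratio M \<phi> A B"
    using magnification_ratio_finite[OF A B] c
    by (metis ennreal_enn2real ennreal_le_iff enn2real_nonneg infinity_ennreal_def)
  also have "\<dots> \<longleftrightarrow> (\<forall>Z\<in>sets M. Z \<subseteq> B \<longrightarrow> 0 < emeasure M Z \<longrightarrow>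
      c * measure M Z \<le> measure M (act_set \<phi> A Z))"
    unfolding magnification_ratio_def le_Inf_iff using ratio by blast
  also have "\<dots> \<longleftrightarrow> (\<forall>Z\<in>sets M. Z \<subseteq> B \<longrightarrow> c * measure M Z \<le> measure M (act_set \<phi> A Z))"
  proof -
    have "measure M Z = 0" if "\<not> 0 < emeasure M Z" for Z
      using that by (simp add: measure_def)
    then show ?thesis
      by (metis measure_nonneg mult_zero_right)
  qed
  finally show ?thesis .
qed

end

theorem theorem1p7:
  fixes G :: "('g, 'm) monoid_scheme" (structure)
    and M :: "'x measure"
    and \<phi> :: "'g \<Rightarrow> 'x \<Rightarrow> 'x"
    and A :: "'g set" and B :: "'x set"
    and j k :: nat
  assumes "comm_group G" and "countable (carrier G)"
    and "measure_action G M \<phi>"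
    and "A \<subseteq> carrier G" and "finite A"
    and "B \<in> sets M" and "0 < emeasure M B" and "emeasure M B < \<infinity>"
    and "0 < j" and "j < k"
  shows "enn2real (magnification_ratio M \<phi> (set_power G A k) B) powr (1 / real k)
       \<le> enn2real (magnification_ratio M \<phi> (set_power G A j) B) powr (1 / real j)"
proof -
  interpret measure_action G M \<phi> by fact
  interpret commuting_measure_maps M \<phi> A
    using assms by (intro commuting_measure_maps) auto
  define C where "C = enn2real (magnification_ratio M \<phi> (set_power G A k) B) powr (1 / real k)"
  have ratio_iff: "c \<le> enn2real (magnification_ratio M \<phi> (set_power G A i) B)
      \<longleftrightarrow> (\<forall>Z\<in>sets M. Z \<subseteq> B \<longrightarrow> c * measure M Z \<le> measure M ((act_set \<phi> A ^^ i) Z))"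
    if "0 \<le> c" for c i
  proof -
    have "act_set \<phi> (set_power G A i) Z = (act_set \<phi> A ^^ i) Z" if "Z \<in> sets M" for Z
      using assms that sets.sets_into_space by (intro act_set_set_power) auto
    then show ?thesis
      using le_magnification_ratio_iff[of "set_power G A i" B c] finite_set_power[of A i]
        set_power_subset_carrier[of A i] assms that by simp
  qed
  have "C \<le> enn2real (magnification_ratio M \<phi> (set_power G A j) B) powr (1 / real j)"
  proof (cases "C = 0")
    case False
    then have C: "0 < C"
      by (simp add: C_def)
    have "C ^ k = enn2real (magnification_ratio M \<phi> (set_power G A k) B)"
      using False assms by (simp add: C_def powr_powr flip: powr_realpow)
    then have "\<forall>Z\<in>sets M. Z \<subseteq> B \<longrightarrow> C ^ k * measure M Z \<le> measure M ((act_set \<phi> A ^^ k) Z)"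
      using ratio_iff[of "C ^ k" k] C by simp
    then have "\<forall>Z\<in>sets M. Z \<subseteq> B \<longrightarrow> C ^ j * measure M Z \<le> measure M ((act_set \<phi> A ^^ j) Z)"
      using growth_at_intermediate_level[OF C _ \<open>0 < j\<close> less_imp_le[OF \<open>j < k\<close>]] assms
      by (auto simp: fmeasurable_def)
    then have "C ^ j \<le> enn2real (magnification_ratio M \<phi> (set_power G A j) B)"
      using ratio_iff[of "C ^ j" j] C by simp
    then have "(C ^ j) powr (1 / real j)
        \<le> enn2real (magnification_ratio M \<phi> (set_power G A j) B) powr (1 / real j)"
      using C by (intro powr_mono2) auto
    then show ?thesis
      using C assms by (simp add: powr_powr flip: powr_realpow)
  qed simp
  then show ?thesis
    by (simp add: C_def)
qed

end
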